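(* Let $n\ge 0$. There are $\mathbb{Q}$-linear maps, depending only on $n$, such that for every graph $G$ on $n$ vertices: (i) the verbose flag vector $f^vG$ is the image of the concise flag vector $f^cG$ under a linear map, i.e. $f^vG$ is a linear function of $f^cG$; and (ii) the subgraph flag vector $f^sG$ is a linear function of $f^cG$, and $f^cG$ is a linear function of $f^sG$.
   Context: Graphs are finite and simple (an edge set is a set of 2-element subsets of the vertex set). "Subgraph of $G$" means a graph with the same vertex set as $G$ and edge set a subset of that of $G$. Verbose flag vector: for a vertex $v$ of $G$ let $m_v$ be the number of edges of $G$ through $v$ and let $G_v$ be the graph obtained by deleting $v$ and all edges through it. Then $f^v$ of the graph on zero vertices is $1$, and otherwise $f^vG=\sum_v (a+m_v b)\,f^vG_v$ (sum over all vertices $v$ of $G$), a homogeneous polynomial of degree $n$ in non-commuting variables $a,b$ (a formal sum of words of length $n$). Partition of a graph: for a graph $H$ on $n$ vertices, $\pi(H)$ is the partition of the integer $n$ given by the sizes of the connected components of $H$. Subgraph flag vector: a shelling of a graph $H$ on $n$ vertices is a removal of its vertices one at a time in some order (equivalently an ordering of the vertex set); when a vertex is removed all remaining edges through it are removed. It is acyclic if at most one edge is removed at each stage. $s^a(H)$ is the number of acyclic shellings of $H$. Then $f^sG=\sum_H s^a(H)\,\pi(H)$, the sum over all subgraphs $H$ of $G$, a formal sum of partitions of $n$. Concise flag vector: for a tree $T$ on $n\ge 3$ vertices, $s(T)$ is the number of ways of shelling $T$ down to a 3-vertex tree (sequences of $n-3$ vertices removed one at a time, each being a leaf of the remaining tree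 when removed); for a tree on at most 3 vertices $s(T)=1$. For an acyclic graph $H$ with component trees $T_1,\dots,T_r$, $s(H)=s(T_1)\cdots s(T_r)$; if $H$ contains a cycle, $s(H)=0$. Then $f^cG=\sum_H s(H)\,\pi(H)$, the sum over all subgraphs $H$ of $G$, a formal sum of partitions of $n$. "$X(G)$ is a linear function of $Y(G)$" means: for each $n$ there is one linear map $L$ (over $\mathbb{Q}$), on the space in which $Y$ of $n$-vertex graphs takes values, with $L(Y(G))=X(G)$ for all $n$-vertex graphs $G$. *)

theory Defs
  imports Complex_Main "HOL-Library.Poly_Mapping" "HOL-Combinatorics.Multiset_Permutations"
begin

subsection \<open>Formal sums\<close>

text \<open>The formal \<open>\<rat>\<close>-linear combinations of elements of a type \<open>'k\<close> are the finitely
  supported functions \<open>'k \<Rightarrow>\<^sub>0 rat\<close>, with the following scalar multiplication.\<close>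

definition rat_scale :: "rat \<Rightarrow> ('k \<Rightarrow>\<^sub>0 rat) \<Rightarrow> ('k \<Rightarrow>\<^sub>0 rat)"
  where "rat_scale c p = Poly_Mapping.map (\<lambda>x. c * x) p"

lemma lookup_rat_scale [simp]: "Poly_Mapping.lookup (rat_scale c p) k = c * Poly_Mapping.lookup p k"
  by (simp add: rat_scale_def Poly_Mapping.map.rep_eq when_def)

lemma vector_space_rat_scale: "vector_space rat_scale"
  by unfold_locales (auto intro!: poly_mapping_eqI simp: Poly_Mapping.lookup_add algebra_simps)

abbreviation rat_linear :: "(('k \<Rightarrow>\<^sub>0 rat) \<Rightarrow> ('l \<Rightarrow>\<^sub>0 rat)) \<Rightarrow> bool"
  where "rat_linear \<equiv> Vector_Spaces.linear rat_scale rat_scale"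


subsection \<open>Non-commutative polynomials in two variables\<close>

text \<open>Words form the free monoid on two letters, written additively so that
  \<open>word \<Rightarrow>\<^sub>0 rat\<close> is its monoid ring: the product is the convolution product provided by
  the library, i.e. concatenation of words extended bilinearly.\<close>

datatype letter = Letter_a | Letter_b

datatype word = Word (letters: "letter list")

instantiation word :: monoid_add
begin

definition zero_word :: word
  where "0 = Word []"

definition plus_word :: "word \<Rightarrow> word \<Rightarrow> word"
  where "u + v = Word (letters u @ letters v)"

instance
  by standard (simp_all add: zero_word_def plus_word_def)

end

definition var_a :: "word \<Rightarrow>\<^sub>0 rat"
  where "var_a = Poly_Mapping.single (Word [Letter_a]) 1"

definition var_b :: "word \<Rightarrow>\<^sub>0 rat"
  where "var_b = Poly_Mapping.single (Word [Letter_b]) 1"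


subsection \<open>Graphs\<close>

text \<open>A graph is given by its vertex set \<open>V\<close> and its edge set \<open>E\<close>; its subgraphs
  (on the same vertex set) are the graphs with edge set in \<open>Pow E\<close>.\<close>

definition simple_graph :: "'a set \<Rightarrow> 'a set set \<Rightarrow> bool"
  where "simple_graph V E \<longleftrightarrow> finite V \<and> (\<forall>e\<in>E. e \<subseteq> V \<and> card e = 2)"

definition vertex_degree :: "'a set set \<Rightarrow> 'a \<Rightarrow> nat"
  where "vertex_degree E v = card {e \<in> E. v \<in> e}"

definition delete_edges_at :: "'a set set \<Rightarrow> 'a \<Rightarrow> 'a set set"
  where "delete_edges_at E v = {e \<in> E. v \<notin> e}"

definition graph_components :: "'a set \<Rightarrow> 'a set set \<Rightarrow> 'a set set"
  where "graph_components V E = V // {(u, v) \<in> V \<times> V. (u, v) \<in> {(x, y). {x, y} \<in> E}\<^sup>*}"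

definition graph_partition :: "'a set \<Rightarrow> 'a set set \<Rightarrow> nat multiset"
  where "graph_partition V E = image_mset card (mset_set (graph_components V E))"

definition has_cycle :: "'a set set \<Rightarrow> bool"
  where "has_cycle E \<longleftrightarrow> (\<exists>vs. length vs \<ge> 3 \<and> distinct vs \<and>
    (\<forall>i < length vs. {vs ! i, vs ! (Suc i mod length vs)} \<in> E))"


subsection \<open>The verbose flag vector\<close>

text \<open>The finiteness test only serves termination.\<close>

function verbose_flag :: "'a set \<Rightarrow> 'a set set \<Rightarrow> (word \<Rightarrow>\<^sub>0 rat)"
  where "verbose_flag V E =
    (if finite V \<and> V \<noteq> {}
     then \<Sum>v\<in>V. (var_a + of_nat (vertex_degree E v) * var_b) *
            verbose_flag (V - {v}) (delete_edges_at E v)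
     else 1)"
  by auto
termination
proof (relation "Wellfounded.measure (\<lambda>(V, E). card V)")
  fix V :: "'a set" and E :: "'a set set" and v
  assume "finite V \<and> V \<noteq> {}" "v \<in> V"
  then show "((V - {v}, delete_edges_at E v), (V, E)) \<in> Wellfounded.measure (\<lambda>(V, E). card V)"
    using card_Diff1_less[of V v] by simp
qed simp

declare verbose_flag.simps [simp del]


subsection \<open>The subgraph flag vector\<close>

fun acyclic_removal :: "'a set set \<Rightarrow> 'a list \<Rightarrow> bool"
  where
    "acyclic_removal E [] \<longleftrightarrow> True"
  | "acyclic_removal E (v # vs) \<longleftrightarrow> vertex_degree E v \<le> 1 \<and> acyclic_removal (delete_edges_at E v) vs"

definition acyclic_shellings :: "'a set \<Rightarrow> 'a set set \<Rightarrow> nat"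
  where "acyclic_shellings V E = card {vs \<in> permutations_of_set V. acyclic_removal E vs}"

definition subgraph_flag :: "'a set \<Rightarrow> 'a set set \<Rightarrow> (nat multiset \<Rightarrow>\<^sub>0 rat)"
  where "subgraph_flag V E =
    (\<Sum>F\<in>Pow E. Poly_Mapping.single (graph_partition V F) (of_nat (acyclic_shellings V F)))"


subsection \<open>The concise flag vector\<close>

fun leaf_removal :: "'a set \<Rightarrow> 'a set set \<Rightarrow> 'a list \<Rightarrow> bool"
  where
    "leaf_removal V E [] \<longleftrightarrow> True"
  | "leaf_removal V E (v # vs) \<longleftrightarrow>
      v \<in> V \<and> vertex_degree E v = 1 \<and> leaf_removal (V - {v}) (delete_edges_at E v) vs"

definition tree_shellings :: "'a set \<Rightarrow> 'a set set \<Rightarrow> nat"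
  where "tree_shellings V E =
    (if card V \<le> 3 then 1 else card {vs. length vs = card V - 3 \<and> leaf_removal V E vs})"

definition forest_shellings :: "'a set \<Rightarrow> 'a set set \<Rightarrow> nat"
  where "forest_shellings V E =
    (if has_cycle E then 0 else \<Prod>C\<in>graph_components V E. tree_shellings C {e \<in> E. e \<subseteq> C})"

definition concise_flag :: "'a set \<Rightarrow> 'a set set \<Rightarrow> (nat multiset \<Rightarrow>\<^sub>0 rat)"
  where "concise_flag V E =
    (\<Sum>F\<in>Pow E. Poly_Mapping.single (graph_partition V F) (of_nat (forest_shellings V F)))"

end

theory Submission
  imports Defs
begin

text \<open>All three vectors are sums over the subgraphs \<open>F\<close> of \<open>G\<close>, once the verbose one is expanded.
  In \<open>\<Sum>v. (a + m\<^sub>v b) f\<^sup>v G\<^sub>v\<close> the term \<open>m\<^sub>v b\<close> is one \<open>b\<close> for each edge through \<open>v\<close>. Choosing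
  at every stage either \<open>a\<close>, or \<open>b\<close> together with one of the edges being removed, amounts to
  choosing a subgraph \<open>F\<close> (the chosen edges) and a vertex ordering that removes at most one edge of
  \<open>F\<close> at each stage. So \<open>f\<^sup>v G\<close> is the sum over all \<open>F\<close> and all acyclic shellings of \<open>F\<close> of a
  word, with an \<open>a\<close> where no edge is removed and a \<open>b\<close> where one is
  (\<open>verbose_flag_eq_sum_shelling_sum\<close>). Replacing both letters by \<open>1\<close> turns the inner sum into the
  number \<open>s\<^sup>a(F)\<close> of acyclic shellings (\<open>acyclic_shellings_eq_shelling_sum\<close>).

  The heart of the matter is \<open>shelling_sum_eq_forest_shellings\<close>: for any values \<open>\<alpha>\<close>, \<open>\<beta>\<close> of the two
  letters in a semiring, the sum over the acyclic shellings of \<open>F\<close> is \<open>s(F)\<close> times a weight that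
  depends on the partition \<open>\<pi>(F)\<close> alone. If \<open>F\<close> has a cycle, both sides vanish: whichever cycle
  vertex goes first takes two edges with it. If \<open>F\<close> is a forest, the first vertex \<open>v\<close> of an acyclic
  shelling is an isolated vertex or a leaf of some component \<open>C\<close>. Its letter, and the partition that
  remains, depend only on the size of \<open>C\<close>; and summing \<open>s(C - v)\<close> over the leaves \<open>v\<close> of \<open>C\<close>
  gives back \<open>s(C)\<close>, except that trees on two or three vertices, for which \<open>s\<close> is \<open>1\<close> by
  convention, have two leaves and give \<open>2 s(C)\<close>. Induction on the number of vertices then yields a
  recursion for the weight in terms of the partition.

  The linear maps act on the basis of partitions: a partition goes to its weight in words to obtain
  \<open>f\<^sup>v\<close> from \<open>f\<^sup>c\<close>, and to itself times its weight for \<open>\<alpha> = \<beta> = 1\<close> to obtain \<open>f\<^sup>s\<close> from \<open>f\<^sup>c\<close>. The latter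
  weight of a partition of \<open>n\<close> is positive (\<open>partition_weight_pos\<close>), so the second map can be
  inverted.\<close>

section \<open>Shelling sums\<close>

text \<open>The sum of the products of letters along all acyclic shellings of a graph on \<open>n\<close> vertices,
  where \<open>\<alpha>\<close> stands for the removal of an isolated vertex and \<open>\<beta>\<close> for that of a leaf. The letters
  range over a semiring so that words and mere counting are covered by one argument.\<close>

primrec shelling_sum :: "'r::semiring_1 \<Rightarrow> 'r \<Rightarrow> nat \<Rightarrow> 'a set \<Rightarrow> 'a set set \<Rightarrow> 'r" where
  "shelling_sum \<alpha> \<beta> 0 V E = 1"
| "shelling_sum \<alpha> \<beta> (Suc n) V E =
    (\<Sum>v\<in>{v\<in>V. vertex_degree E v \<le> 1}. (if vertex_degree E v = 0 then \<alpha> else \<beta>) *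
       shelling_sum \<alpha> \<beta> n (V - {v}) (delete_edges_at E v))"

lemma simple_graph_finite_edges:
  assumes "simple_graph V E"
  shows "finite E"
proof (rule finite_subset)
  show "E \<subseteq> Pow V" "finite (Pow V)"
    using assms by (auto simp: simple_graph_def)
qed

lemma simple_graph_delete:
  assumes "simple_graph V E"
  shows "simple_graph (V - {v}) (delete_edges_at E v)"
  using assms by (auto simp: simple_graph_def delete_edges_at_def)

lemma simple_graph_subset:
  assumes "simple_graph V E" "F \<subseteq> E"
  shows "simple_graph V F"
  using assms by (auto simp: simple_graph_def)

text \<open>A subgraph \<open>F\<close> of \<open>E\<close> with at most one edge at \<open>v\<close> is a subgraph of \<open>E\<close> without \<open>v\<close> together
  with either no edge (contributing \<open>\<alpha>\<close>) or one of the edges of \<open>E\<close> at \<open>v\<close> (contributing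
  \<open>\<beta>\<close> each).\<close>

lemma sum_subgraphs_at_vertex:
  fixes \<alpha> \<beta> :: "'r::semiring_1"
  assumes "finite E"
  shows "(\<Sum>F\<in>{F\<in>Pow E. vertex_degree F v \<le> 1}.
            (if vertex_degree F v = 0 then \<alpha> else \<beta>) * g (delete_edges_at F v))
       = (\<alpha> + of_nat (vertex_degree E v) * \<beta>) * (\<Sum>F\<in>Pow (delete_edges_at E v). g F)"
proof -
  define S where "S = {e\<in>E. v \<in> e}"
  define T where "T = insert {} ((\<lambda>e. {e}) ` S)"
  have finS: "finite S"
    using assms by (simp add: S_def)
  have T_eq: "T = {X\<in>Pow S. card X \<le> 1}"
  proof -
    have "X \<in> T" if "X \<subseteq> S" "card X \<le> 1" for X
    proof (cases "card X = 0")
      case True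
      then show ?thesis
        using that finite_subset[OF that(1) finS] by (simp add: T_def)
    next
      case False
      then have "card X = 1"
        using that by simp
      then obtain e where "X = {e}"
        by (auto simp: card_1_singleton_iff)
      then show ?thesis
        using that by (simp add: T_def)
    qed
    then show ?thesis
      by (auto simp: T_def)
  qed
  have "(\<Sum>F\<in>{F\<in>Pow E. vertex_degree F v \<le> 1}.
            (if vertex_degree F v = 0 then \<alpha> else \<beta>) * g (delete_edges_at F v))
      = (\<Sum>(X, F)\<in>T \<times> Pow (delete_edges_at E v). (if card X = 0 then \<alpha> else \<beta>) * g F)"
  proof (rule sum.reindex_bij_witness[where i = "\<lambda>(X, F). X \<union> F"
        and j = "\<lambda>F. ({e\<in>F. v \<in> e}, delete_edges_at F v)"])
    fix p assume "p \<in> T \<times> Pow (delete_edges_at E v)"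
    then obtain X F where p: "p = (X, F)" "X \<subseteq> S" "card X \<le> 1" "F \<subseteq> delete_edges_at E v"
      by (auto simp: T_eq)
    have *: "{e \<in> X \<union> F. v \<in> e} = X" "delete_edges_at (X \<union> F) v = F"
      using p by (auto simp: S_def delete_edges_at_def)
    show "({e \<in> case p of (X, F) \<Rightarrow> X \<union> F. v \<in> e},
           delete_edges_at (case p of (X, F) \<Rightarrow> X \<union> F) v) = p"
      using * p by simp
    show "(case p of (X, F) \<Rightarrow> X \<union> F) \<in> {F\<in>Pow E. vertex_degree F v \<le> 1}"
      using * p by (auto simp: vertex_degree_def S_def delete_edges_at_def)
  qed (auto simp: T_eq S_def vertex_degree_def delete_edges_at_def)
  also have "\<dots> = (\<Sum>X\<in>T. if card X = 0 then \<alpha> else \<beta>) * (\<Sum>F\<in>Pow (delete_edges_at E v). g F)"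
    by (simp add: sum_product sum.cartesian_product)
  also have "(\<Sum>X\<in>T. if card X = 0 then \<alpha> else \<beta>) = \<alpha> + of_nat (vertex_degree E v) * \<beta>"
  proof -
    have "(\<Sum>X\<in>T. if card X = 0 then \<alpha> else \<beta>)
        = \<alpha> + (\<Sum>X\<in>(\<lambda>e. {e}) ` S. if card X = 0 then \<alpha> else \<beta>)"
      unfolding T_def using finS by (subst sum.insert) auto
    also have "\<dots> = \<alpha> + (\<Sum>e\<in>S. \<beta>)"
      by (subst sum.reindex) auto
    finally show ?thesis
      by (simp add: vertex_degree_def S_def)
  qed
  finally show ?thesis .
qed

lemma verbose_flag_eq_sum_shelling_sum:
  assumes "simple_graph V E" "card V = n"
  shows "verbose_flag V E = (\<Sum>F\<in>Pow E. shelling_sum var_a var_b n V F)"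
  using assms
proof (induction n arbitrary: V E)
  case 0
  then have [simp]: "V = {}"
    by (auto simp: simple_graph_def)
  have "E = {}"
    using 0 by (auto simp: simple_graph_def)
  then show ?case
    by (simp add: verbose_flag.simps[of "{}"])
next
  case (Suc n)
  have fin: "finite V" "finite E"
    using Suc.prems simple_graph_finite_edges by (auto simp: simple_graph_def)
  have "V \<noteq> {}"
    using Suc.prems by auto
  have "(\<Sum>F\<in>Pow E. shelling_sum var_a var_b (Suc n) V F)
      = (\<Sum>v\<in>V. \<Sum>F\<in>{F\<in>Pow E. vertex_degree F v \<le> 1}.
            (if vertex_degree F v = 0 then var_a else var_b) *
            shelling_sum var_a var_b n (V - {v}) (delete_edges_at F v))"
    unfolding shelling_sum.simps using fin by (intro sum.swap_restrict) auto
  also have "\<dots> = (\<Sum>v\<in>V. (var_a + of_nat (vertex_degree E v) * var_b) *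
        (\<Sum>F\<in>Pow (delete_edges_at E v). shelling_sum var_a var_b n (V - {v}) F))"
    by (intro sum.cong refl sum_subgraphs_at_vertex fin)
  also have "\<dots> = (\<Sum>v\<in>V. (var_a + of_nat (vertex_degree E v) * var_b) *
        verbose_flag (V - {v}) (delete_edges_at E v))"
    using Suc.prems fin
    by (intro sum.cong refl arg_cong2[where f = "(*)"] Suc.IH[symmetric] simple_graph_delete) auto
  also have "\<dots> = verbose_flag V E"
    using fin \<open>V \<noteq> {}\<close> by (subst (2) verbose_flag.simps) simp
  finally show ?case ..
qed

lemma acyclic_shellings_eq_shelling_sum:
  assumes "finite V" "card V = n"
  shows "acyclic_shellings V E = shelling_sum 1 1 n V E"
  using assms
proof (induction n arbitrary: V E)
  case 0
  have "{vs. vs = [] \<and> acyclic_removal E vs} = {[]}"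
    by auto
  with 0 show ?case
    by (simp add: acyclic_shellings_def)
next
  case (Suc n)
  let ?A = "{v\<in>V. vertex_degree E v \<le> 1}"
  let ?P = "\<lambda>v. {vs\<in>permutations_of_set (V - {v}). acyclic_removal (delete_edges_at E v) vs}"
  have "V \<noteq> {}"
    using Suc.prems by auto
  then have "{vs\<in>permutations_of_set V. acyclic_removal E vs} = (\<Union>v\<in>?A. (#) v ` ?P v)"
    by (auto simp: permutations_of_set_nonempty)
  then have "acyclic_shellings V E = (\<Sum>v\<in>?A. card ((#) v ` ?P v))"
    unfolding acyclic_shellings_def using Suc.prems by (simp, subst card_UN_disjoint) auto
  also have "\<dots> = (\<Sum>v\<in>?A. acyclic_shellings (V - {v}) (delete_edges_at E v))"
    by (simp add: card_image acyclic_shellings_def)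
  also have "\<dots> = (\<Sum>v\<in>?A. shelling_sum 1 1 n (V - {v}) (delete_edges_at E v))"
    using Suc.prems by (intro sum.cong refl Suc.IH) auto
  finally show ?case
    by simp
qed


section \<open>Graphs with a cycle\<close>

lemma has_cycle_mono:
  assumes "has_cycle F" "F \<subseteq> E"
  shows "has_cycle E"
  using assms unfolding has_cycle_def by blast

text \<open>A vertex on a cycle is joined to its predecessor and its successor, and these differ because
  the cycle has length at least three.\<close>

lemma cycle_vertex_degree:
  assumes "finite E" "distinct vs" "length vs \<ge> 3"
    "\<forall>i < length vs. {vs ! i, vs ! (Suc i mod length vs)} \<in> E" "v \<in> set vs"
  shows "vertex_degree E v \<ge> 2"
proof -
  let ?l = "length vs"
  obtain i where i: "i < ?l" "v = vs ! i"
    using assms(5) by (auto simp: in_set_conv_nth)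
  define j where "j = (if i = 0 then ?l - 1 else i - 1)"
  define k where "k = Suc i mod ?l"
  have j: "j < ?l" "Suc j mod ?l = i"
    using i assms(3) by (auto simp: j_def)
  have k: "k < ?l" "k = (if Suc i = ?l then 0 else Suc i)"
    using i assms(3) by (auto simp: k_def mod_Suc)
  have "j \<noteq> k" "j \<noteq> i" "k \<noteq> i"
    using i k assms(3) by (auto simp: j_def split: if_splits)
  then have ne: "vs ! j \<noteq> vs ! k" "vs ! j \<noteq> v" "vs ! k \<noteq> v"
    using i j k assms(2) by (simp_all add: nth_eq_iff_index_eq)
  have "{vs ! j, v} \<in> E" "{v, vs ! k} \<in> E"
    using assms(4) i j k_def by metis+
  then have "{{vs ! j, v}, {v, vs ! k}} \<subseteq> {e\<in>E. v \<in> e}"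
    by auto
  then have "card {{vs ! j, v}, {v, vs ! k}} \<le> vertex_degree E v"
    unfolding vertex_degree_def using assms(1) by (intro card_mono) auto
  moreover have "{vs ! j, v} \<noteq> {v, vs ! k}"
    using ne by (auto simp: doubleton_eq_iff)
  ultimately show ?thesis
    by simp
qed

text \<open>A vertex of degree at most one is not on the cycle, so the cycle survives its removal; hence a
  shelling that removes at most one edge at a time never gets through.\<close>

lemma shelling_sum_has_cycle:
  assumes "simple_graph V E" "card V = n" "has_cycle E"
  shows "shelling_sum \<alpha> \<beta> n V E = 0"
  using assms
proof (induction n arbitrary: V E)
  case 0
  then have "E = {}"
    by (auto simp: simple_graph_def)
  moreover have "\<not> has_cycle ({} :: 'a set set)"
  proof -
    have "\<exists>i. i < length vs" if "length vs \<ge> 3" for vs :: "'a list"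
      using that by (intro exI[of _ 0]) auto
    then show ?thesis
      by (auto simp: has_cycle_def)
  qed
  ultimately show ?case
    using 0 by simp
next
  case (Suc n)
  have fin: "finite V" "finite E"
    using Suc.prems simple_graph_finite_edges by (auto simp: simple_graph_def)
  obtain vs where vs: "length vs \<ge> 3" "distinct vs"
      "\<forall>i < length vs. {vs ! i, vs ! (Suc i mod length vs)} \<in> E"
    using Suc.prems by (auto simp: has_cycle_def)
  have "shelling_sum \<alpha> \<beta> n (V - {v}) (delete_edges_at E v) = 0"
    if v: "v \<in> V" "vertex_degree E v \<le> 1" for v
  proof (rule Suc.IH)
    have "v \<notin> set vs"
      using cycle_vertex_degree[OF fin(2) vs(2,1,3), of v] v by auto
    moreover have "Suc i mod length vs < length vs" for i
      using vs(1) by (intro mod_less_divisor) auto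
    ultimately have "{vs ! i, vs ! (Suc i mod length vs)} \<in> delete_edges_at E v"
      if "i < length vs" for i
      using vs(3) that by (auto simp: delete_edges_at_def)
    then show "has_cycle (delete_edges_at E v)"
      unfolding has_cycle_def using vs by blast
  qed (use Suc.prems v fin in \<open>auto intro: simple_graph_delete\<close>)
  then show ?case
    by simp
qed


section \<open>Components after removal of a vertex\<close>

definition reach :: "'a set set \<Rightarrow> ('a \<times> 'a) set"
  where "reach E = {(x, y). {x, y} \<in> E}\<^sup>*"

definition component :: "'a set \<Rightarrow> 'a set set \<Rightarrow> 'a \<Rightarrow> 'a set"
  where "component V E x = {y\<in>V. (x, y) \<in> reach E}"

lemma graph_components_eq: "graph_components V E = component V E ` V"
  by (auto simp: graph_components_def component_def reach_def quotient_def)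

lemma reach_refl [simp]: "(x, x) \<in> reach E"
  by (simp add: reach_def)

lemma reach_sym: "(x, y) \<in> reach E \<Longrightarrow> (y, x) \<in> reach E"
proof -
  have "sym {(x, y). {x, y} \<in> E}"
    by (auto simp: sym_def insert_commute)
  then show "(x, y) \<in> reach E \<Longrightarrow> (y, x) \<in> reach E"
    unfolding reach_def by (meson sym_rtrancl symD)
qed

lemma reach_trans: "(x, y) \<in> reach E \<Longrightarrow> (y, z) \<in> reach E \<Longrightarrow> (x, z) \<in> reach E"
  unfolding reach_def by (rule rtrancl_trans)

lemma reach_edge: "{x, y} \<in> E \<Longrightarrow> (x, y) \<in> reach E"
  unfolding reach_def by (rule r_into_rtrancl) simp

lemma component_self: "v \<in> V \<Longrightarrow> v \<in> component V E v"
  by (simp add: component_def)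

lemma component_unique:
  assumes "C \<in> graph_components V E" "v \<in> C"
  shows "C = component V E v"
  using assms by (auto simp: graph_components_eq component_def intro: reach_trans reach_sym)

lemma Union_graph_components: "\<Union> (graph_components V E) = V"
  by (auto simp: graph_components_eq component_def)

lemma graph_component_edge:
  assumes "simple_graph V E" "C \<in> graph_components V E" "v \<in> C" "e \<in> E" "v \<in> e"
  shows "e \<subseteq> C"
proof
  fix w assume "w \<in> e"
  have "e \<subseteq> V" "card e = 2"
    using assms by (auto simp: simple_graph_def)
  then have "(v, w) \<in> reach E"
    using assms(4,5) \<open>w \<in> e\<close> by (cases "v = w") (auto simp: card_2_iff insert_commute intro!: reach_edge)
  then show "w \<in> C"
    using component_unique[OF assms(2,3)] \<open>e \<subseteq> V\<close> \<open>w \<in> e\<close> by (auto simp: component_def)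
qed

text \<open>A vertex with at most one neighbour is not needed to connect two others.\<close>

lemma reach_delete_edges_at:
  assumes "simple_graph V E" "vertex_degree E v \<le> 1" "x \<noteq> v" "y \<noteq> v"
  shows "(x, y) \<in> reach (delete_edges_at E v) \<longleftrightarrow> (x, y) \<in> reach E"
proof
  show "(x, y) \<in> reach (delete_edges_at E v) \<Longrightarrow> (x, y) \<in> reach E"
    unfolding reach_def by (rule rtrancl_mono[THEN subsetD, rotated]) (auto simp: delete_edges_at_def)
next
  assume xy: "(x, y) \<in> reach E"
  have "finite {e\<in>E. v \<in> e}"
    using simple_graph_finite_edges[OF assms(1)] by simp
  then have unique: "e = e'" if "e \<in> E" "e' \<in> E" "v \<in> e" "v \<in> e'" for e e'
    using assms(2) that unfolding vertex_degree_def by (auto simp: card_le_Suc0_iff_eq)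
  obtain u where u: "\<And>w. {v, w} \<in> E \<Longrightarrow> w = u"
  proof (cases "\<exists>u. {v, u} \<in> E")
    case True
    then obtain u where "{v, u} \<in> E" ..
    then have "w = u" if "{v, w} \<in> E" for w
      using unique[of "{v, w}" "{v, u}"] that by (auto simp: doubleton_eq_iff)
    then show ?thesis
      using that by blast
  qed (use that in blast)
  have no_loop: "{w} \<notin> E" for w
    using assms(1) by (auto simp: simple_graph_def)
  \<comment> \<open>Sending \<open>v\<close> to its only neighbour \<open>u\<close> retracts walks in \<open>E\<close> onto walks that avoid \<open>v\<close>.\<close>
  define f where "f z = (if z = v then u else z)" for z
  from xy have "(f x, f y) \<in> reach (delete_edges_at E v)"
    unfolding reach_def
  proof (induction rule: rtrancl_induct)
    case (step y z)
    then have yz: "{y, z} \<in> E"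
      by simp
    then have "y \<noteq> z"
      using no_loop by auto
    have "f y = f z \<or> {f y, f z} \<in> delete_edges_at E v"
    proof (cases "y = v \<or> z = v")
      case True
      then show ?thesis
        using yz u \<open>y \<noteq> z\<close> by (auto simp: f_def insert_commute)
    next
      case False
      then show ?thesis
        using yz by (auto simp: f_def delete_edges_at_def)
    qed
    then show ?case
      using step.IH by (auto intro: rtrancl_into_rtrancl)
  qed simp
  then show "(x, y) \<in> reach (delete_edges_at E v)"
    using assms(3,4) by (simp add: f_def)
qed

text \<open>Only the component of the removed vertex changes; it is not split, as the vertex has at most
  one neighbour, but it disappears if it consisted of that vertex only.\<close>

lemma graph_components_delete:
  assumes "simple_graph V E" "C \<in> graph_components V E" "v \<in> C" "vertex_degree E v \<le> 1"
  shows "graph_components (V - {v}) (delete_edges_at E v)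
       = (graph_components V E - {C}) \<union> (if C = {v} then {} else {C - {v}})"
proof -
  have C: "C = component V E v" and "v \<in> V"
    using component_unique[OF assms(2,3)] assms(2,3) Union_graph_components[of V E] by auto
  have del: "component (V - {v}) (delete_edges_at E v) x = component V E x - {v}"
    if "x \<in> V - {v}" for x
    using that reach_delete_edges_at[OF assms(1,4)] by (auto simp: component_def)
  have other: "component V E x - {v} = component V E x" if "x \<in> V" "x \<notin> C" for x
    using that by (auto simp: C component_def intro: reach_sym)
  have same: "component V E x = C" if "x \<in> C" for x
    using component_unique[OF assms(2) that] by simp
  have eq: "graph_components (V - {v}) (delete_edges_at E v)
      = (\<lambda>x. component V E x - {v}) ` (V - {v})"
    unfolding graph_components_eq by (intro image_cong refl del)
  also have "(\<lambda>x. component V E x - {v}) ` (V - {v})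
      = (\<lambda>x. component V E x - {v}) ` ((V - C) \<union> (C - {v}))"
    using assms(3) by (intro arg_cong[where f = "(`) _"]) (auto simp: C component_def)
  also have "\<dots> = component V E ` (V - C) \<union> (\<lambda>x. C - {v}) ` (C - {v})"
    unfolding image_Un by (intro arg_cong2[where f = "(\<union>)"] image_cong refl) (simp_all add: other same)
  also have "component V E ` (V - C) = graph_components V E - {C}"
    using component_self[of _ V E] same by (auto simp: graph_components_eq)
  also have "(\<lambda>x. C - {v}) ` (C - {v}) = (if C = {v} then {} else {C - {v}})"
    using assms(3) by auto
  finally show ?thesis .
qed

lemma isolated_iff_singleton_component:
  assumes "simple_graph V E" "C \<in> graph_components V E" "v \<in> C"
  shows "vertex_degree E v = 0 \<longleftrightarrow> C = {v}"
proof
  assume "vertex_degree E v = 0"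
  then have "{e\<in>E. v \<in> e} = {}"
    unfolding vertex_degree_def using simple_graph_finite_edges[OF assms(1)] by (subst (asm) card_0_eq) auto
  then have none: "{v, z} \<notin> E" for z
    by auto
  have "w = v" if "(v, w) \<in> reach E" for w
    using that unfolding reach_def by (induction rule: rtrancl_induct) (auto simp: none)
  then show "C = {v}"
    using component_unique[OF assms(2,3)] assms(3) by (auto simp: component_def)
next
  assume "C = {v}"
  have False if e: "e \<in> E" "v \<in> e" for e
  proof -
    have "e = {v}"
      using graph_component_edge[OF assms e] e(2) \<open>C = {v}\<close> by auto
    then show False
      using assms(1) e(1) by (auto simp: simple_graph_def)
  qed
  then have "{e\<in>E. v \<in> e} = {}"
    by blast
  then show "vertex_degree E v = 0"
    by (simp only: vertex_degree_def card.empty)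
qed


section \<open>Removing a leaf from a tree\<close>

text \<open>The ratio between the sum of \<open>s(T - v)\<close> over the vertices \<open>v\<close> of degree at most one and
  \<open>s(T)\<close>, for a tree \<open>T\<close> on \<open>m\<close> vertices. It differs from \<open>1\<close> only for the two smallest trees
  with edges: both have two leaves, but \<open>s\<close> equals \<open>1\<close> there and after the removal.\<close>

definition leaf_factor :: "nat \<Rightarrow> nat"
  where "leaf_factor m = (if m = 2 \<or> m = 3 then 2 else 1)"

text \<open>Sort the shellings of a tree down to three vertices by the leaf removed first.\<close>

lemma tree_shellings_rec:
  assumes "finite C" "card C \<ge> 4"
  shows "tree_shellings C D
    = (\<Sum>v\<in>{v\<in>C. vertex_degree D v = 1}. tree_shellings (C - {v}) (delete_edges_at D v))"
proof -
  let ?L = "{v\<in>C. vertex_degree D v = 1}"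
  let ?P = "\<lambda>V E k. {vs. length vs = k \<and> leaf_removal V E vs}"
  \<comment> \<open>On three vertices the value \<open>1\<close> set by convention counts the empty shelling.\<close>
  have eq: "tree_shellings V E = card (?P V E (card V - 3))" if "card V \<ge> 3"
    for V :: "'a set" and E
  proof (cases "card V = 3")
    case True
    have "{vs. vs = [] \<and> leaf_removal V E vs} = {[]}"
      by auto
    with True show ?thesis
      by (simp add: tree_shellings_def)
  qed (use that in \<open>simp add: tree_shellings_def\<close>)
  have sub: "set vs \<subseteq> V" if "leaf_removal V E vs" for V :: "'a set" and E vs
    using that by (induction V E vs rule: leaf_removal.induct) auto
  have fin: "finite (?P V E k)" if "finite V" for V :: "'a set" and E k
    by (rule finite_subset[OF _ finite_lists_length_eq[OF that, of k]]) (use sub in blast)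
  define k where "k = card C - 4"
  have k: "card C - 3 = Suc k"
    using assms(2) by (simp add: k_def)
  have "?P C D (Suc k) = (\<Union>v\<in>?L. (#) v ` ?P (C - {v}) (delete_edges_at D v) k)"
    by (auto simp: length_Suc_conv)
  then have "tree_shellings C D = (\<Sum>v\<in>?L. card ((#) v ` ?P (C - {v}) (delete_edges_at D v) k))"
    using eq[of C D] assms k fin by (simp, subst card_UN_disjoint) auto
  also have "\<dots> = (\<Sum>v\<in>?L. card (?P (C - {v}) (delete_edges_at D v) k))"
    by (simp add: card_image)
  also have "\<dots> = (\<Sum>v\<in>?L. tree_shellings (C - {v}) (delete_edges_at D v))"
  proof (intro sum.cong refl)
    fix v assume "v \<in> ?L"
    then have "card (C - {v}) - 3 = k" "card (C - {v}) \<ge> 3"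
      using assms k by auto
    then show "card (?P (C - {v}) (delete_edges_at D v) k)
        = tree_shellings (C - {v}) (delete_edges_at D v)"
      using eq by metis
  qed
  finally show ?thesis .
qed

text \<open>Without isolated vertices at least two of the three possible edges are present, and without a
  triangle at most two; so the graph is a path, and its ends are the leaves.\<close>

lemma three_vertex_tree_leaves:
  assumes "simple_graph C D" "\<not> has_cycle D" "card C = 3" "\<forall>v\<in>C. vertex_degree D v \<noteq> 0"
  shows "card {v\<in>C. vertex_degree D v \<le> 1} = 2"
proof -
  obtain x y z where xyz: "C = {x, y, z}" "x \<noteq> y" "x \<noteq> z" "y \<noteq> z"
    using assms(3) by (auto simp: card_3_iff)
  have edge: "e \<subseteq> C" "card e = 2" if "e \<in> D" for e
    using assms(1) that by (auto simp: simple_graph_def)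
  have deg: "vertex_degree D p = of_bool ({p, q} \<in> D) + of_bool ({p, r} \<in> D)"
    if "C = {p, q, r}" "p \<noteq> q" "p \<noteq> r" "q \<noteq> r" for p q r
  proof -
    have "e \<in> {{p, q}, {p, r}}" if "e \<in> D" "p \<in> e" for e
      using edge[OF \<open>e \<in> D\<close>] \<open>p \<in> e\<close> \<open>C = {p, q, r}\<close> by (auto simp: card_2_iff doubleton_eq_iff)
    then have "{e\<in>D. p \<in> e} = (if {p, q} \<in> D then {{p, q}} else {}) \<union> (if {p, r} \<in> D then {{p, r}} else {})"
      by auto
    moreover have "{p, q} \<noteq> {p, r}"
      using that by (auto simp: doubleton_eq_iff)
    ultimately show ?thesis
      by (simp add: vertex_degree_def)
  qed
  have not_all: "\<not> ({x, y} \<in> D \<and> {y, z} \<in> D \<and> {x, z} \<in> D)"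
  proof
    assume "{x, y} \<in> D \<and> {y, z} \<in> D \<and> {x, z} \<in> D"
    then have "\<forall>i < length [x, y, z]. {[x, y, z] ! i, [x, y, z] ! (Suc i mod length [x, y, z])} \<in> D"
      by (auto simp: less_Suc_eq insert_commute)
    then have "has_cycle D"
      unfolding has_cycle_def using xyz by (intro exI[of _ "[x, y, z]"]) simp
    then show False
      using assms(2) by contradiction
  qed
  have d: "vertex_degree D x = of_bool ({x, y} \<in> D) + of_bool ({x, z} \<in> D)"
    "vertex_degree D y = of_bool ({x, y} \<in> D) + of_bool ({y, z} \<in> D)"
    "vertex_degree D z = of_bool ({x, z} \<in> D) + of_bool ({y, z} \<in> D)"
    using deg[of x y z] deg[of y x z] deg[of z x y] xyz by (auto simp: insert_commute)
  have "finite C"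
    using assms(1) by (simp add: simple_graph_def)
  then have "card {v\<in>C. vertex_degree D v \<le> 1} = (\<Sum>v\<in>C. of_bool (vertex_degree D v \<le> 1))"
    by (simp add: Int_def)
  also have "\<dots> = of_bool (vertex_degree D x \<le> 1) + of_bool (vertex_degree D y \<le> 1)
      + of_bool (vertex_degree D z \<le> 1)"
    using xyz by simp
  also have "\<dots> = 2"
  proof -
    have "vertex_degree D x \<noteq> 0" "vertex_degree D y \<noteq> 0" "vertex_degree D z \<noteq> 0"
      using assms(4) xyz(1) by blast+
    then show ?thesis
      using not_all unfolding d
      by (cases "{x, y} \<in> D"; cases "{y, z} \<in> D"; cases "{x, z} \<in> D"; simp)
  qed
  finally show ?thesis .
qed

text \<open>Of the connectedness of a tree \<open>(C, D)\<close> it is enough to know that no vertex is isolated unless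
  it is the only one.\<close>

lemma sum_tree_shellings_delete:
  assumes "simple_graph C D" "\<not> has_cycle D" "C \<noteq> {}"
    and deg0: "\<And>v. v \<in> C \<Longrightarrow> vertex_degree D v = 0 \<longleftrightarrow> C = {v}"
  shows "(\<Sum>v\<in>{v\<in>C. vertex_degree D v \<le> 1}. tree_shellings (C - {v}) (delete_edges_at D v))
       = leaf_factor (card C) * tree_shellings C D"
proof -
  let ?L = "{v\<in>C. vertex_degree D v \<le> 1}"
  have fin: "finite C"
    using assms(1) by (simp add: simple_graph_def)
  have "card C \<noteq> 0"
    using fin assms(3) by simp
  show ?thesis
  proof (cases "card C \<ge> 4")
    case True
    then have "vertex_degree D v \<noteq> 0" if "v \<in> C" for v
      using deg0[OF that] by auto
    then have "?L = {v\<in>C. vertex_degree D v = 1}"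
      by (intro Collect_cong) (metis One_nat_def le_Suc_eq le_zero_eq order_refl)
    then show ?thesis
      using True by (simp add: leaf_factor_def tree_shellings_rec[OF fin True])
  next
    case False
    have "card (C - {v}) \<le> 3" for v
      using False card_Diff1_le[of C v] by simp
    then have "(\<Sum>v\<in>?L. tree_shellings (C - {v}) (delete_edges_at D v)) = (\<Sum>v\<in>?L. 1)"
      by (intro sum.cong refl) (simp only: tree_shellings_def if_True)
    also have "\<dots> = card ?L"
      by simp
    also have "card ?L = leaf_factor (card C)"
    proof -
      consider "card C = 1" | "card C = 2" | "card C = 3"
        using False \<open>card C \<noteq> 0\<close> by linarith
      then show ?thesis
      proof cases
        case 1
        then obtain v where C: "C = {v}"
          by (auto simp: card_1_singleton_iff)
        then have "?L = {v}"
          using deg0[of v] by auto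
        then show ?thesis
          by (simp add: C leaf_factor_def)
      next
        case 2
        have "vertex_degree D v \<le> 1" if "v \<in> C" for v
        proof -
          have "e = C" if "e \<in> D" for e
            using assms(1) 2 fin that by (intro card_subset_eq) (auto simp: simple_graph_def)
          then have "{e\<in>D. v \<in> e} \<subseteq> {C}"
            by auto
          then have "card {e\<in>D. v \<in> e} \<le> card {C}"
            by (intro card_mono) auto
          then show ?thesis
            by (simp add: vertex_degree_def)
        qed
        then have "?L = C"
          by auto
        then show ?thesis
          using 2 by (simp add: leaf_factor_def)
      next
        case 3
        then have "\<forall>v\<in>C. vertex_degree D v \<noteq> 0"
          using deg0 by auto
        then show ?thesis
          using three_vertex_tree_leaves[OF assms(1,2) 3] 3 by (simp add: leaf_factor_def)
      qed
    qed
    finally show ?thesis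
      using False by (simp add: tree_shellings_def)
  qed
qed


section \<open>Shelling sums of forests\<close>

text \<open>The effect on the partition of a forest of removing a leaf or an isolated vertex from a
  component of size \<open>m\<close>.\<close>

definition shrink_part :: "nat \<Rightarrow> nat multiset \<Rightarrow> nat multiset"
  where "shrink_part m p = (p - {#m#}) + (if m \<le> 1 then {#} else {#m - 1#})"

text \<open>The shelling sum of a forest with partition \<open>p\<close> of \<open>n\<close>, stripped of the factor \<open>s\<close>. The recursion follows the first step of an acyclic shelling, one summand for
  each component from which the first vertex may be taken.\<close>

primrec partition_weight :: "'r::semiring_1 \<Rightarrow> 'r \<Rightarrow> nat \<Rightarrow> nat multiset \<Rightarrow> 'r" where
  "partition_weight \<alpha> \<beta> 0 p = 1"
| "partition_weight \<alpha> \<beta> (Suc n) p =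
    (\<Sum>m\<in>#p. of_nat (leaf_factor m) * (if m = 1 then \<alpha> else \<beta>) *
       partition_weight \<alpha> \<beta> n (shrink_part m p))"

lemma finite_graph_components:
  assumes "simple_graph V E"
  shows "finite (graph_components V E)"
  using assms by (simp add: graph_components_eq simple_graph_def)

text \<open>This keeps the union in \<open>graph_components_delete\<close> disjoint, so that sums and products over
  it split.\<close>

lemma graph_component_delete_fresh:
  assumes "C \<in> graph_components V E" "v \<in> C" "C \<noteq> {v}"
  shows "C - {v} \<notin> graph_components V E"
proof
  assume *: "C - {v} \<in> graph_components V E"
  obtain w where "w \<in> C - {v}"
    using assms(2,3) by blast
  then have "C - {v} = C"
    using component_unique[OF *, of w] component_unique[OF assms(1), of w] by auto
  then show False
    using assms(2) by blast
qed

lemma graph_partition_delete: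
  assumes "simple_graph V E" "C \<in> graph_components V E" "v \<in> C" "vertex_degree E v \<le> 1"
  shows "graph_partition (V - {v}) (delete_edges_at E v)
       = shrink_part (card C) (graph_partition V E)"
proof -
  have fin: "finite (graph_components V E)"
    by (rule finite_graph_components) fact
  have "finite C"
    using assms(1,2) by (auto simp: graph_components_eq component_def simple_graph_def)
  have C1: "card C \<le> 1 \<longleftrightarrow> C = {v}"
    using assms(3) \<open>finite C\<close> by (auto simp: le_Suc_eq card_1_singleton_iff)
  have rest: "image_mset card (mset_set (graph_components V E - {C}))
      = graph_partition V E - {#card C#}"
    using fin assms(2) by (simp add: graph_partition_def mset_set_Diff image_mset_Diff)
  note new = graph_component_delete_fresh[OF assms(2,3)]
  show ?thesis
  proof (cases "C = {v}")
    case True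
    then show ?thesis
      using rest by (simp add: graph_partition_def graph_components_delete[OF assms] shrink_part_def)
  next
    case False
    then show ?thesis
      using rest new fin C1 assms(3) \<open>finite C\<close>
      by (simp add: graph_partition_def[of "V - {v}"] graph_components_delete[OF assms] shrink_part_def)
  qed
qed

text \<open>Removing \<open>v\<close> changes only the factor of its own component \<open>C\<close>. If \<open>C\<close> is \<open>{v}\<close>, that factor
  disappears from the product; the right-hand side is still correct because \<open>s\<close> is \<open>1\<close> on the
  empty vertex set.\<close>

lemma forest_shellings_delete:
  assumes "simple_graph V E" "C \<in> graph_components V E" "v \<in> C" "vertex_degree E v \<le> 1"
    and "\<not> has_cycle E"
  shows "forest_shellings (V - {v}) (delete_edges_at E v)
       = (\<Prod>B\<in>graph_components V E - {C}. tree_shellings B {e\<in>E. e \<subseteq> B}) *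
         tree_shellings (C - {v}) (delete_edges_at {e\<in>E. e \<subseteq> C} v)"
proof -
  have fin: "finite (graph_components V E)"
    by (rule finite_graph_components) fact
  let ?E = "delete_edges_at E v"
  let ?t = "\<lambda>B. tree_shellings B {e\<in>?E. e \<subseteq> B}"
  have acyclic: "\<not> has_cycle ?E"
    using assms(5) has_cycle_mono[of ?E E] by (auto simp: delete_edges_at_def)
  have "v \<notin> B" if "B \<in> graph_components V E - {C}" for B
    using that component_unique[of _ V E v] assms(2,3) by auto
  then have "{e\<in>?E. e \<subseteq> B} = {e\<in>E. e \<subseteq> B}" if "B \<in> graph_components V E - {C}" for B
    using that by (auto simp: delete_edges_at_def)
  then have rest: "(\<Prod>B\<in>graph_components V E - {C}. ?t B)
      = (\<Prod>B\<in>graph_components V E - {C}. tree_shellings B {e\<in>E. e \<subseteq> B})"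
    by (intro prod.cong) auto
  have "{e\<in>?E. e \<subseteq> C - {v}} = delete_edges_at {e\<in>E. e \<subseteq> C} v"
    by (auto simp: delete_edges_at_def)
  then have C: "?t (C - {v}) = tree_shellings (C - {v}) (delete_edges_at {e\<in>E. e \<subseteq> C} v)"
    by simp
  show ?thesis
  proof (cases "C = {v}")
    case True
    then show ?thesis
      using rest acyclic
      by (simp add: forest_shellings_def graph_components_delete[OF assms(1-4)])
        (simp add: tree_shellings_def)
  next
    case False
    then have "C - {v} \<notin> graph_components V E"
      by (rule graph_component_delete_fresh[OF assms(2,3)])
    then show ?thesis
      using rest acyclic False fin C
      by (simp add: forest_shellings_def graph_components_delete[OF assms(1-4)] mult.commute)
  qed
qed

text \<open>The key identity, by induction along the first vertex of the shelling. The first vertices are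
  grouped by component, because the letter and the remaining partition are constant on each
  component and the remaining numbers \<open>s\<close> add up to a multiple of \<open>s\<close> by
  \<open>sum_tree_shellings_delete\<close>.\<close>

theorem shelling_sum_eq_forest_shellings:
  fixes \<alpha> \<beta> :: "'r::semiring_1"
  assumes "simple_graph V E" "card V = n"
  shows "shelling_sum \<alpha> \<beta> n V E
       = of_nat (forest_shellings V E) * partition_weight \<alpha> \<beta> n (graph_partition V E)"
proof (cases "has_cycle E")
  case True
  then show ?thesis
    by (simp add: shelling_sum_has_cycle[OF assms] forest_shellings_def)
next
  case False
  with assms show ?thesis
  proof (induction n arbitrary: V E)
    case 0
    then have "V = {}"
      by (auto simp: simple_graph_def)
    then show ?case
      using 0 by (simp add: forest_shellings_def graph_components_eq)
  next
    case (Suc n)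
    note sg = \<open>simple_graph V E\<close> and acyclic = \<open>\<not> has_cycle E\<close>
    have fin: "finite V"
      using sg by (simp add: simple_graph_def)
    let ?comps = "graph_components V E"
    let ?p = "graph_partition V E"
    let ?t = "\<lambda>B. tree_shellings B {e\<in>E. e \<subseteq> B}"
    let ?x = "\<lambda>m. (if m = (1::nat) then \<alpha> else \<beta>)"
    let ?g = "\<lambda>v. (if vertex_degree E v = 0 then \<alpha> else \<beta>) *
       shelling_sum \<alpha> \<beta> n (V - {v}) (delete_edges_at E v)"
    let ?w = "\<lambda>C. partition_weight \<alpha> \<beta> n (shrink_part (card C) ?p)"
    have comp_fin: "finite C" if "C \<in> ?comps" for C
      using fin that by (auto simp: graph_components_eq component_def)
    have fin_comps: "finite ?comps"
      by (rule finite_graph_components) fact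
    \<comment> \<open>The contribution of the shellings whose first vertex lies in the component \<open>C\<close>.\<close>
    have at_C: "(\<Sum>v\<in>{v\<in>C. vertex_degree E v \<le> 1}. ?g v)
        = of_nat (forest_shellings V E) * (of_nat (leaf_factor (card C)) * ?x (card C) * ?w C)"
      if C: "C \<in> ?comps" for C
    proof -
      let ?D = "{e\<in>E. e \<subseteq> C}"
      let ?r = "\<Prod>B\<in>?comps - {C}. ?t B"
      have deg: "vertex_degree ?D v = vertex_degree E v" if "v \<in> C" for v
        using graph_component_edge[OF sg C that] unfolding vertex_degree_def
        by (intro arg_cong[where f = card]) auto
      have tree: "(\<Sum>v\<in>{v\<in>C. vertex_degree E v \<le> 1}. tree_shellings (C - {v}) (delete_edges_at ?D v))
          = leaf_factor (card C) * ?t C"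
      proof -
        have "simple_graph C ?D"
          using sg comp_fin[OF C] by (auto simp: simple_graph_def)
        moreover have "\<not> has_cycle ?D"
          using acyclic has_cycle_mono[of ?D E] by auto
        moreover have "C \<noteq> {}"
          using C component_self[of _ V E] by (auto simp: graph_components_eq)
        moreover have "vertex_degree ?D v = 0 \<longleftrightarrow> C = {v}" if "v \<in> C" for v
          using isolated_iff_singleton_component[OF sg C that] deg[OF that] by simp
        moreover have "{v\<in>C. vertex_degree E v \<le> 1} = {v\<in>C. vertex_degree ?D v \<le> 1}"
          using deg by auto
        ultimately show ?thesis
          using sum_tree_shellings_delete[of C ?D] by simp
      qed
      have "?g v = ?x (card C) * of_nat (?r * tree_shellings (C - {v}) (delete_edges_at ?D v)) * ?w C"
        if v: "v \<in> C" "vertex_degree E v \<le> 1" for v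
      proof -
        have "v \<in> V"
          using v(1) C Union_graph_components[of V E] by auto
        have "vertex_degree E v = 0 \<longleftrightarrow> card C = 1"
          using isolated_iff_singleton_component[OF sg C v(1)] v(1)
          by (auto simp: card_1_singleton_iff)
        moreover have "shelling_sum \<alpha> \<beta> n (V - {v}) (delete_edges_at E v)
            = of_nat (forest_shellings (V - {v}) (delete_edges_at E v)) *
              partition_weight \<alpha> \<beta> n (graph_partition (V - {v}) (delete_edges_at E v))"
        proof (rule Suc.IH)
          show "\<not> has_cycle (delete_edges_at E v)"
            using acyclic has_cycle_mono[of "delete_edges_at E v" E]
            by (auto simp: delete_edges_at_def)
        qed (use Suc.prems \<open>v \<in> V\<close> fin in \<open>auto intro: simple_graph_delete\<close>)
        ultimately show ?thesis
          unfolding forest_shellings_delete[OF sg C v acyclic] graph_partition_delete[OF sg C v]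
          by (simp add: mult.assoc)
      qed
      then have "(\<Sum>v\<in>{v\<in>C. vertex_degree E v \<le> 1}. ?g v)
          = (\<Sum>v\<in>{v\<in>C. vertex_degree E v \<le> 1}.
              ?x (card C) * of_nat (?r * tree_shellings (C - {v}) (delete_edges_at ?D v)) * ?w C)"
        by (intro sum.cong) auto
      also have "\<dots> = ?x (card C) * of_nat (?r * (leaf_factor (card C) * ?t C)) * ?w C"
        unfolding tree[symmetric] sum_distrib_left of_nat_sum sum_distrib_right ..
      also have "?r * (leaf_factor (card C) * ?t C) = forest_shellings V E * leaf_factor (card C)"
        using acyclic fin_comps C by (simp add: forest_shellings_def prod.remove[of _ C])
      \<comment> \<open>\<open>\<alpha>\<close> and \<open>\<beta>\<close> need not commute with anything, but natural numbers commute with them.\<close>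
      also have "?x (card C) * of_nat (forest_shellings V E * leaf_factor (card C)) * ?w C
          = of_nat (forest_shellings V E) * (of_nat (leaf_factor (card C)) * ?x (card C) * ?w C)"
        unfolding mult_of_nat_commute[of _ "?x (card C)", symmetric] by (simp add: mult.assoc)
      finally show ?thesis .
    qed
    have "{v\<in>V. vertex_degree E v \<le> 1} = (\<Union>C\<in>?comps. {v\<in>C. vertex_degree E v \<le> 1})"
      using Union_graph_components[of V E] by auto
    then have "shelling_sum \<alpha> \<beta> (Suc n) V E
        = (\<Sum>v\<in>(\<Union>C\<in>?comps. {v\<in>C. vertex_degree E v \<le> 1}). ?g v)"
      by simp
    also have "\<dots> = (\<Sum>C\<in>?comps. \<Sum>v\<in>{v\<in>C. vertex_degree E v \<le> 1}. ?g v)"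
    proof (rule sum.UNION_disjoint)
      show "\<forall>A\<in>?comps. \<forall>B\<in>?comps. A \<noteq> B \<longrightarrow>
          {v\<in>A. vertex_degree E v \<le> 1} \<inter> {v\<in>B. vertex_degree E v \<le> 1} = {}"
        using component_unique[of _ V E] by blast
    qed (use fin_comps comp_fin in auto)
    also have "\<dots> = (\<Sum>C\<in>?comps. of_nat (forest_shellings V E) *
        (of_nat (leaf_factor (card C)) * ?x (card C) * ?w C))"
      by (intro sum.cong refl at_C)
    also have "\<dots> = of_nat (forest_shellings V E) * partition_weight \<alpha> \<beta> (Suc n) ?p"
      by (simp add: sum_distrib_left[symmetric] graph_partition_def multiset.map_comp comp_def
          sum_unfold_sum_mset)
    finally show ?case .
  qed
qed

text \<open>As long as the parts add up to a positive number, some part can be shrunk by one, so the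
  recursion always has a positive summand.\<close>

lemma partition_weight_pos:
  assumes "sum_mset p = n"
  shows "partition_weight 1 1 n p > (0::nat)"
  using assms
proof (induction n arbitrary: p)
  case (Suc n)
  then have "\<exists>m. m \<in># p \<and> m \<noteq> 0"
    by (metis nat.distinct(1) sum_mset_0_iff)
  then obtain m where m: "m \<in># p" "m \<noteq> 0"
    by blast
  then obtain q where p: "p = add_mset m q"
    by (meson mset_add)
  have "sum_mset (shrink_part m p) = n"
    using Suc.prems m by (auto simp: shrink_part_def p)
  then have "partition_weight 1 1 n (shrink_part m p) > (0::nat)"
    by (rule Suc.IH)
  moreover have "leaf_factor m > 0"
    by (simp add: leaf_factor_def)
  ultimately show ?case
    by (simp add: p)
qed simp

lemma sum_mset_graph_partition:
  assumes "simple_graph V E"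
  shows "sum_mset (graph_partition V E) = card V"
proof -
  have "finite V"
    using assms by (simp add: simple_graph_def)
  have "card (\<Union> (graph_components V E)) = (\<Sum>C\<in>graph_components V E. card C)"
  proof (rule card_Union_disjoint)
    show "pairwise disjnt (graph_components V E)"
      using component_unique[of _ V E] unfolding pairwise_def disjnt_def by blast
    show "\<And>C. C \<in> graph_components V E \<Longrightarrow> finite C"
      using \<open>finite V\<close> by (auto simp: graph_components_eq component_def)
  qed
  then show ?thesis
    by (simp add: Union_graph_components graph_partition_def sum_unfold_sum_mset)
qed


section \<open>Linear maps between flag vectors\<close>

text \<open>The formal sums with a single term of coefficient \<open>1\<close> form a basis, so a linear map may be
  prescribed on them. The values are given directly for sums indexed by an arbitrary set, the form in which the
  flag vectors are defined.\<close>

lemma rat_linear_extension: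
  fixes g :: "'k \<Rightarrow> 'l \<Rightarrow>\<^sub>0 rat"
  obtains L where "rat_linear L"
    "\<And>(A :: 'i set) c k. L (\<Sum>i\<in>A. Poly_Mapping.single (k i) (c i)) = (\<Sum>i\<in>A. rat_scale (c i) (g (k i)))"
proof -
  interpret l: vector_space "rat_scale :: rat \<Rightarrow> ('l \<Rightarrow>\<^sub>0 rat) \<Rightarrow> _"
    by (rule vector_space_rat_scale)
  define L where "L p = (\<Sum>k\<in>Poly_Mapping.keys p. rat_scale (Poly_Mapping.lookup p k) (g k))" for p
  have L_eq: "L p = (\<Sum>k\<in>K. rat_scale (Poly_Mapping.lookup p k) (g k))"
    if "finite K" "Poly_Mapping.keys p \<subseteq> K" for p K
    unfolding L_def using that
    by (intro sum.mono_neutral_left) (auto simp: in_keys_iff l.scale_zero_left)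
  have add: "L (p + q) = L p + L q" for p q
  proof -
    let ?K = "Poly_Mapping.keys p \<union> Poly_Mapping.keys q"
    have "Poly_Mapping.keys (p + q) \<subseteq> ?K"
      by (rule Poly_Mapping.keys_add)
    then show ?thesis
      by (simp add: L_eq[of ?K] lookup_add sum.distrib[symmetric]
          l.scale_left_distrib)
  qed
  have scale: "L (rat_scale c p) = rat_scale c (L p)" for c p
  proof -
    have "Poly_Mapping.keys (rat_scale c p) \<subseteq> Poly_Mapping.keys p"
      by (auto simp: in_keys_iff)
    then show ?thesis
      by (simp add: L_eq[of "Poly_Mapping.keys p"]
          l.scale_sum_right
          l.scale_scale)
  qed
  have linear: "rat_linear L"
    unfolding Vector_Spaces.linear_iff by (intro conjI allI add scale vector_space_rat_scale)
  have single: "L (Poly_Mapping.single k c) = rat_scale c (g k)" for k c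
    by (subst L_eq[of "{k}"]) auto
  have "L (\<Sum>i\<in>A. Poly_Mapping.single (k i) (c i)) = (\<Sum>i\<in>A. rat_scale (c i) (g (k i)))"
    for A :: "'i set" and c k
    using Vector_Spaces.linear.axioms(3)[OF linear, THEN module_hom.sum, of "\<lambda>i. Poly_Mapping.single (k i) (c i)" A]
    by (simp add: single)
  then show thesis
    using that linear by blast
qed

lemma rat_scale_of_nat: "rat_scale (of_nat k) p = of_nat k * (p :: 'k::monoid_add \<Rightarrow>\<^sub>0 rat)"
proof (induction k)
  case (Suc k)
  have "rat_scale (of_nat (Suc k)) p = p + rat_scale (of_nat k) p"
    by (intro poly_mapping_eqI) (simp add: lookup_add algebra_simps)
  then show ?case
    by (simp add: Suc algebra_simps)
qed (auto intro: poly_mapping_eqI)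

lemma rat_scale_single:
  "rat_scale c (Poly_Mapping.single k d) = Poly_Mapping.single k (c * d)"
  by (intro poly_mapping_eqI) (simp add: lookup_single when_def)

theorem theorem24:
  fixes n :: nat
  shows "(\<exists>L. rat_linear L \<and>
            (\<forall>(V :: 'a set) E. simple_graph V E \<and> card V = n \<longrightarrow>
               L (concise_flag V E) = verbose_flag V E))
       \<and> (\<exists>L. rat_linear L \<and>
            (\<forall>(V :: 'a set) E. simple_graph V E \<and> card V = n \<longrightarrow>
               L (concise_flag V E) = subgraph_flag V E))
       \<and> (\<exists>L. rat_linear L \<and>
            (\<forall>(V :: 'a set) E. simple_graph V E \<and> card V = n \<longrightarrow>
               L (subgraph_flag V E) = concise_flag V E))"
proof (intro conjI)
  define \<kappa> :: "nat multiset \<Rightarrow> nat" where "\<kappa> = partition_weight 1 1 n"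
  have acyclic_shellings: "acyclic_shellings V F = forest_shellings V F * \<kappa> (graph_partition V F)"
    and pos: "\<kappa> (graph_partition V F) \<noteq> 0"
    if "simple_graph V E" "card V = n" "F \<in> Pow E" for V :: "'a set" and E F
  proof -
    have F: "simple_graph V F"
      using that simple_graph_subset by blast
    have "finite V"
      using F by (simp add: simple_graph_def)
    then show "acyclic_shellings V F = forest_shellings V F * \<kappa> (graph_partition V F)"
      using acyclic_shellings_eq_shelling_sum[of V n F]
        shelling_sum_eq_forest_shellings[OF F that(2), of 1 "1 :: nat"] that(2)
      by (simp add: \<kappa>_def)
    show "\<kappa> (graph_partition V F) \<noteq> 0"
      using partition_weight_pos[OF sum_mset_graph_partition[OF F]] that(2) by (simp add: \<kappa>_def)
  qed

  \<comment> \<open>From the concise to the verbose flag vector: weigh partitions by words.\<close>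
  obtain L where L: "rat_linear L"
    "\<And>(A :: 'a set set set) c k. L (\<Sum>F\<in>A. Poly_Mapping.single (k F) (c F))
      = (\<Sum>F\<in>A. rat_scale (c F) (partition_weight var_a var_b n (k F)))"
    by (rule rat_linear_extension[of "partition_weight var_a var_b n"]) blast
  have "L (concise_flag V E) = verbose_flag V E"
    if "simple_graph V E" "card V = n" for V :: "'a set" and E
    unfolding concise_flag_def L(2) rat_scale_of_nat verbose_flag_eq_sum_shelling_sum[OF that]
    using that simple_graph_subset
    by (intro sum.cong refl shelling_sum_eq_forest_shellings[symmetric]) auto
  with L(1) show "\<exists>L. rat_linear L \<and> (\<forall>(V :: 'a set) E. simple_graph V E \<and> card V = n \<longrightarrow>
      L (concise_flag V E) = verbose_flag V E)"
    by blast

  \<comment> \<open>From the concise to the subgraph flag vector: a diagonal map.\<close>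
  obtain L where L: "rat_linear L"
    "\<And>(A :: 'a set set set) c k. L (\<Sum>F\<in>A. Poly_Mapping.single (k F) (c F))
      = (\<Sum>F\<in>A. rat_scale (c F) (Poly_Mapping.single (k F) (of_nat (\<kappa> (k F)))))"
    by (rule rat_linear_extension[of "\<lambda>p. Poly_Mapping.single p (of_nat (\<kappa> p))"]) blast
  have "L (concise_flag V E) = subgraph_flag V E"
    if "simple_graph V E" "card V = n" for V :: "'a set" and E
    unfolding concise_flag_def L(2) subgraph_flag_def rat_scale_single
    by (intro sum.cong refl) (simp add: acyclic_shellings[OF that])
  with L(1) show "\<exists>L. rat_linear L \<and> (\<forall>(V :: 'a set) E. simple_graph V E \<and> card V = n \<longrightarrow>
      L (concise_flag V E) = subgraph_flag V E)"
    by blast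

  \<comment> \<open>Back again: the inverse diagonal entries, \<open>\<kappa>\<close> being nonzero on the partitions that occur.\<close>
  obtain L where L: "rat_linear L"
    "\<And>(A :: 'a set set set) c k. L (\<Sum>F\<in>A. Poly_Mapping.single (k F) (c F))
      = (\<Sum>F\<in>A. rat_scale (c F) (Poly_Mapping.single (k F) (1 / of_nat (\<kappa> (k F)))))"
    by (rule rat_linear_extension[of "\<lambda>p. Poly_Mapping.single p (1 / of_nat (\<kappa> p))"]) blast
  have "L (subgraph_flag V E) = concise_flag V E"
    if "simple_graph V E" "card V = n" for V :: "'a set" and E
    unfolding concise_flag_def L(2) subgraph_flag_def rat_scale_single
    by (intro sum.cong refl) (simp add: acyclic_shellings[OF that] pos[OF that])
  with L(1) show "\<exists>L. rat_linear L \<and> (\<forall>(V :: 'a set) E. simple_graph V E \<and> card V = n \<longrightarrow>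
      L (subgraph_flag V E) = concise_flag V E)"
    by blast
qed

end
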